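(* Let $\mathcal X=[d]$ and let $\mathcal Y$ be a finite set. For a real matrix $A$ with $d$ columns put $\Gamma(A)=\det(A^\top A)$ (the Gram determinant score). (a) The Gram determinant score is experiment agnostic: for all $Q,Q'\in GL_d(\mathbb R)$ and all $P\in\mathcal P_{\mathrm{indep}}$, $$\Gamma(Q)\ge\Gamma(Q')\iff\Gamma(PQ)\ge\Gamma(PQ').$$ (b) Let $S:GL_d(\mathbb R)\to\mathbb R_{>0}$ be a continuous function and $c:\mathbb R_{>0}\to\mathbb R_{>0}$ a continuous function such that for all $Q,Q',P\in GL_d(\mathbb R)$ and all $t>0$, $$S(Q)\ge S(Q')\iff S(PQ)\ge S(PQ')\qquad\text{and}\qquad S(tQ)=c(t)S(Q).$$ Then there exist $\alpha>0$ and $\beta\ne0$ such that $S(Q)=\alpha\det(Q^\top Q)^{\beta}$ for all $Q\in GL_d(\mathbb R)$.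
   Context: An experiment is a column-stochastic matrix $P\in\mathbb R^{|\mathcal Y|\times d}$; $\mathcal P_{\mathrm{indep}}$ is the set of experiments with linearly independent columns. $GL_d(\mathbb R)$ is the general linear group of invertible real $d\times d$ matrices.
   Formalization: In (b) the score S is additionally assumed to be non-constant on GL_d(R): the constant score S = 1 with c = 1 meets all the stated hypotheses but is not α·det(QᵀQ)^β with β ≠ 0. *)

theory Defs
  imports "HOL-Analysis.Analysis"
begin

definition gram_score :: "real^'d^'m \<Rightarrow> real" where
  "gram_score A = det (transpose A ** A)"

definition GL :: "(real^'d^'d) set" where
  "GL = {Q. invertible Q}"

(* In real^'d^'y the index in 'y is the row index: P $ y $ x is the probability of
   observing y in state x. *)
definition is_experiment :: "real^'d^'y \<Rightarrow> bool" where
  "is_experiment P \<longleftrightarrow> (\<forall>y x. 0 \<le> P $ y $ x) \<and> (\<forall>x. (\<Sum>y\<in>UNIV. P $ y $ x) = 1)"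

(* Linear independence of the family of columns: since columns P is a set and
   forgets repetitions, injectivity is required separately. *)
definition P_indep :: "(real^'d^'y) set" where
  "P_indep = {P. is_experiment P \<and> inj (\<lambda>x. column x P) \<and> independent (columns P)}"

(* A constant score is order-invariant under GL and homogeneous (with c = 1), but it is not
   a nonzero power of the Gram determinant.  This is why the characterisation of
   gram_score has to assume that S is not constant on GL. *)
lemma constant_score_not_power_of_gram_score:
  "\<not> (\<exists>\<alpha>>0. \<exists>\<beta>. \<beta> \<noteq> 0 \<and> (\<forall>Q\<in>(GL :: (real^'d^'d) set). (1::real) = \<alpha> * gram_score Q powr \<beta>))"
proof clarify
  fix \<alpha> \<beta> :: real
  assume "\<alpha> > 0" "\<beta> \<noteq> 0"
    and eq: "\<forall>Q\<in>(GL :: (real^'d^'d) set). 1 = \<alpha> * gram_score Q powr \<beta>"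
  have score: "gram_score (mat k :: real^'d^'d) = (k * k) ^ CARD('d)" for k :: real
  proof -
    have "det (mat k :: real^'d^'d) = k ^ CARD('d)"
      by (subst det_diagonal) (auto simp: mat_def)
    then show ?thesis
      by (simp add: gram_score_def det_mul power_mult_distrib)
  qed
  have inGL: "(mat k :: real^'d^'d) \<in> GL" if "k \<noteq> 0" for k :: real
    using that by (simp add: GL_def invertible_det_nz det_diagonal mat_def)
  have "\<alpha> = 1"
    using eq[rule_format, OF inGL[of 1]] by (simp add: score)
  with eq[rule_format, OF inGL[of 2]] have "((4::real) ^ CARD('d)) powr \<beta> = 1"
    by (simp add: score)
  moreover have "(4::real) ^ CARD('d) > 1"
    by (rule one_less_power) auto
  ultimately show False
    using \<open>\<beta> \<noteq> 0\<close> by (simp add: powr_eq_one_iff_gen)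
qed

end

theory Submission
  imports Defs
begin

text \<open>Part (a) is multiplicativity of the determinant together with positivity of
  \<open>det (transpose P ** P)\<close>. For part (b), the preorder induced by \<open>S\<close> is invariant under left
  multiplication, so an involution \<open>A\<close> must be equivalent to the identity: \<open>A \<ge> I\<close> would give
  \<open>I = A\<^sup>2 \<ge> A\<close>, and likewise for \<open>A \<le> I\<close>. Matrices equivalent to the identity form a
  subgroup, and involutions generate all matrices of determinant \<open>\<plusminus>1\<close>. Hence \<open>S Q\<close> depends
  only on the scaling factor \<open>\<bar>det Q\<bar> powr (1/d)\<close> and equals the value of \<open>c\<close> there times
  \<open>S I\<close>; since \<open>c\<close> is continuous and multiplicative, it is a power function.\<close>

section \<open>Gram determinants\<close>

lemma det_scaleR: "det (r *\<^sub>R A) = r ^ CARD('n) * det (A :: real^'n^'n)"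
proof -
  have "r *\<^sub>R A = mat r ** A"
    by (simp add: matrix_matrix_mult_def mat_def vec_eq_iff if_distrib if_distribR cong: if_cong)
  moreover have "det (mat r :: real^'n^'n) = r ^ CARD('n)"
    by (subst det_diagonal) (auto simp: mat_def)
  ultimately show ?thesis
    by (simp add: det_mul)
qed

lemma det_pos_if_positive_definite:
  fixes M :: "real^'n^'n"
  assumes pos: "\<And>x. x \<noteq> 0 \<Longrightarrow> x \<bullet> (M *v x) > 0"
  shows "det M > 0"
proof -
  \<comment> \<open>The determinant is continuous and does not vanish on the segment from \<open>M\<close> to the identity.\<close>
  define N where "N t = t *\<^sub>R M + (1 - t) *\<^sub>R mat 1" for t
  have nz: "det (N t) \<noteq> 0" if "0 \<le> t" "t \<le> 1" for t
  proof -
    have "x = 0" if "N t *v x = 0" for x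
    proof (rule ccontr)
      assume "x \<noteq> 0"
      \<comment> \<open>For \<open>t > 0\<close> the first summand is positive and the second
        nonnegative; at \<open>t = 0\<close> only \<open>x \<bullet> x\<close> remains.\<close>
      then have "0 < t * (x \<bullet> (M *v x)) + (1 - t) * (x \<bullet> x)"
        using pos[of x] \<open>0 \<le> t\<close> \<open>t \<le> 1\<close>
        by (cases "t = 0") (auto intro!: add_pos_nonneg)
      also have "\<dots> = x \<bullet> (N t *v x)"
        by (simp add: N_def matrix_vector_mult_add_rdistrib inner_add_right
            flip: scaleR_matrix_vector_assoc)
      finally show False
        using that by simp
    qed
    then have "\<exists>B. B ** N t = mat 1"
      by (simp add: matrix_left_invertible_ker)
    then show ?thesis
      by (simp add: invertible_left_inverse flip: invertible_det_nz)
  qed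
  have "continuous_on {0..1} (\<lambda>t. det (N t))"
    unfolding N_def det_def by (intro continuous_intros)
  then have cont: "continuous_on {0..1} (\<lambda>t. - det (N t))"
    by (rule continuous_on_minus)
  show ?thesis
  proof (rule ccontr)
    assume "\<not> det M > 0"
    then obtain t where "0 \<le> t" "t \<le> 1" "- det (N t) = 0"
      using IVT'[OF _ _ _ cont, of 0] by (auto simp: N_def)
    then show False
      using nz by simp
  qed
qed

text \<open>The quadratic form of the Gram matrix at \<open>x\<close> is the squared length of
  \<open>P *v x\<close>, and independent columns give \<open>P\<close> a trivial kernel.\<close>

lemma gram_score_pos:
  fixes P :: "real^'d^'m"
  assumes inj: "inj (\<lambda>x. column x P)" and indep: "independent (columns P)"
  shows "gram_score P > 0"
  unfolding gram_score_def
proof (rule det_pos_if_positive_definite)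
  fix x :: "real^'d"
  assume "x \<noteq> 0"
  have "P *v x \<noteq> 0"
  proof
    assume "P *v x = 0"
    \<comment> \<open>Independence speaks of coefficients attached to vectors, not indices; as no
      column repeats, \<open>u\<close> transfers the coordinates of \<open>x\<close> to the
      columns.\<close>
    define u where "u v = x $ (inv (\<lambda>i. column i P) v)" for v
    have cols: "columns P = range (\<lambda>i. column i P)"
      by (auto simp: columns_def)
    have "(\<Sum>v\<in>columns P. u v *\<^sub>R v) = (\<Sum>i\<in>UNIV. x $ i *\<^sub>R column i P)"
      by (simp add: cols sum.reindex[OF inj] u_def inv_f_f[OF inj])
    also have "\<dots> = P *v x"
      by (simp add: matrix_mult_sum scalar_mult_eq_scaleR)
    finally have "(\<Sum>v\<in>columns P. u v *\<^sub>R v) = 0"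
      using \<open>P *v x = 0\<close> by simp
    moreover have "finite (columns P)"
      by (simp add: cols)
    ultimately have "u (column i P) = 0" for i
      using independentD[OF indep _ order_refl] cols by blast
    then have "x = 0"
      by (simp add: u_def inv_f_f[OF inj] vec_eq_iff)
    with \<open>x \<noteq> 0\<close> show False by simp
  qed
  moreover have "x \<bullet> ((transpose P ** P) *v x) = (P *v x) \<bullet> (P *v x)"
    by (metis dot_lmul_matrix inner_commute matrix_vector_mul_assoc transpose_matrix_vector)
  ultimately show "x \<bullet> ((transpose P ** P) *v x) > 0"
    by simp
qed

text \<open>An experiment changes the score only by a positive factor common to all
  \<open>Q\<close>, so it preserves comparisons.\<close>

lemma gram_score_mult:
  fixes P :: "real^'d^'m" and Q :: "real^'d^'d"
  shows "gram_score (P ** Q) = gram_score P * (det Q)\<^sup>2"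
proof -
  have "transpose (P ** Q) ** (P ** Q) = transpose Q ** (transpose P ** P) ** Q"
    by (simp add: matrix_transpose_mul matrix_mul_assoc)
  then show ?thesis
    by (simp add: gram_score_def det_mul power2_eq_square)
qed

lemma gram_score_square: "gram_score (Q :: real^'d^'d) = (det Q)\<^sup>2"
  by (simp add: gram_score_def det_mul power2_eq_square)

section \<open>Generation by involutions\<close>

text \<open>Covers diagonal matrices (\<open>p = id\<close>) and permutation matrices
  (\<open>f\<close> constantly 1) in one form closed under products, so being an involution can be
  checked on \<open>f\<close> and \<open>p\<close>.\<close>

definition monomial_matrix :: "('n \<Rightarrow> real) \<Rightarrow> ('n \<Rightarrow> 'n) \<Rightarrow> real^'n^'n" where
  "monomial_matrix f p = (\<chi> i j. if j = p i then f i else 0)"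

lemma monomial_matrix_mult:
  "monomial_matrix f p ** monomial_matrix g q = monomial_matrix (\<lambda>i. f i * g (p i)) (q \<circ> p)"
proof -
  have "(\<Sum>k\<in>UNIV. (if k = p i then f i else 0) * (if j = q k then g k else 0)) =
      (if j = q (p i) then f i * g (p i) else 0)" for i j
    by (subst sum.mono_neutral_right[of _ "{p i}"]) auto
  then show ?thesis
    by (simp add: monomial_matrix_def matrix_matrix_mult_def vec_eq_iff)
qed

lemma matrix_mult_diagonal: "A ** monomial_matrix f id = (\<chi> i j. A $ i $ j * f j)"
proof -
  have "(\<Sum>k\<in>UNIV. A $ i $ k * (if j = id k then f k else 0)) = A $ i $ j * f j" for i j
    by (subst sum.mono_neutral_right[of _ "{j}"]) auto
  then show ?thesis
    by (simp add: monomial_matrix_def matrix_matrix_mult_def vec_eq_iff)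
qed

lemma monomial_matrix_1_id: "monomial_matrix (\<lambda>_. 1) id = mat 1"
  by (auto simp: monomial_matrix_def mat_def vec_eq_iff)

lemma monomial_matrix_involution:
  assumes "\<And>i. p (p i) = i" and "\<And>i. f i * f (p i) = 1"
  shows "monomial_matrix f p ** monomial_matrix f p = mat 1"
  unfolding monomial_matrix_mult monomial_matrix_1_id[symmetric]
  using assms by (auto simp: monomial_matrix_def vec_eq_iff)

lemma abs_det_involution:
  fixes A :: "real^'n^'n"
  assumes "A ** A = mat 1"
  shows "\<bar>det A\<bar> = 1"
proof -
  have "det A * det A = 1"
    using assms by (metis det_I det_mul)
  then show ?thesis
    by (auto simp: square_eq_1_iff)
qed

context
  fixes P :: "real^'n^'n \<Rightarrow> bool"
  assumes involution: "\<And>A. A ** A = mat 1 \<Longrightarrow> P A"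
    and mult: "\<And>A B. P A \<Longrightarrow> P B \<Longrightarrow> P (A ** B)"
begin

private lemma swap: "P (monomial_matrix (\<lambda>_. 1) (Transposition.transpose j k))"
  by (intro involution monomial_matrix_involution) auto

text \<open>On coordinates \<open>j\<close> and \<open>k\<close>, diag(a, 1/a) is the involution
  with off-diagonal entries a and 1/a, followed by the swap.\<close>

private lemma inverse_pair:
  assumes "j \<noteq> k" "a \<noteq> 0"
  shows "P (monomial_matrix (\<lambda>i. if i = j then a else if i = k then inverse a else 1) id)"
proof -
  define f where "f i = (if i = j then a else if i = k then inverse a else 1)" for i
  define p where "p = Transposition.transpose j k"
  have "f i * f (p i) = 1" for i
    using assms by (auto simp: f_def p_def transpose_def)
  then have "P (monomial_matrix f p)"
    by (intro involution monomial_matrix_involution) (auto simp: p_def)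
  then have "P (monomial_matrix f p ** monomial_matrix (\<lambda>_. 1) p)"
    using mult swap unfolding p_def by blast
  moreover have "p \<circ> p = id"
    by (simp add: p_def)
  ultimately show ?thesis
    unfolding monomial_matrix_mult f_def by simp
qed

private lemma diagonal:
  fixes f :: "'n \<Rightarrow> real"
  assumes f: "\<bar>\<Prod>i\<in>UNIV. f i\<bar> = 1"
  shows "P (monomial_matrix f id)"
proof -
  have nz: "f i \<noteq> 0" for i
    using f by (metis abs_zero finite iso_tuple_UNIV_I prod_zero zero_neq_one)
  fix k :: 'n
  \<comment> \<open>The entries in \<open>F\<close> are compensated by the entry at \<open>k\<close>, so the determinant of \<open>E F\<close> is 1.\<close>
  define E where "E F = monomial_matrix
    (\<lambda>i. if i \<in> F then f i else if i = k then inverse (prod f F) else 1) id" for F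
  have E: "P (E F)" if "finite F" "k \<notin> F" for F
    using that
  proof (induction F rule: finite_induct)
    case empty
    have "E {} = mat 1"
      by (auto simp: E_def monomial_matrix_def mat_def vec_eq_iff)
    then show ?case
      by (simp add: involution)
  next
    case (insert j F)
    then have "j \<noteq> k" and IH: "P (E F)"
      by auto
    have "E F ** monomial_matrix (\<lambda>i. if i = j then f j else if i = k then inverse (f j) else 1) id
        = E (insert j F)"
      using insert unfolding E_def matrix_mult_diagonal
      by (auto simp: monomial_matrix_def vec_eq_iff)
    then show ?case
      using mult[OF IH inverse_pair[OF \<open>j \<noteq> k\<close> nz[of j]]] by simp
  qed
  define F where "F = UNIV - {k}"
  have split: "prod f UNIV = f k * prod f F"
    unfolding F_def by (rule prod.remove) auto
  \<comment> \<open>At \<open>k\<close>, \<open>E F\<close> has \<open>inverse (prod f F)\<close>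
    instead of \<open>f k\<close>. The quotient is the full product of \<open>f\<close>, hence 1 or
    -1, so the correction is an involution.\<close>
  define D where "D = monomial_matrix (\<lambda>i. if i = k then prod f UNIV else 1) id"
  have "prod f UNIV = 1 \<or> prod f UNIV = -1"
    using f by linarith
  then have "P D"
    unfolding D_def by (intro involution monomial_matrix_involution) auto
  moreover have "P (E F)"
    by (rule E) (auto simp: F_def)
  moreover have "E F ** D = monomial_matrix f id"
  proof -
    have "prod f F \<noteq> 0"
      using nz by simp
    then show ?thesis
      unfolding E_def D_def matrix_mult_diagonal split
      by (auto simp: monomial_matrix_def vec_eq_iff F_def)
  qed
  ultimately show ?thesis
    using mult by metis
qed

text \<open>Negating column \<open>n\<close> of the shear gives a map that fixes the other basis
  vectors and sends e_n to -e_n - e_m. This is an involution, and so is the sign change that undoes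
  the negation.\<close>

private lemma shear:
  assumes "m \<noteq> n"
  shows "P (\<chi> i j. of_bool (i = m \<and> j = n \<or> i = j))" (is "P ?A")
proof -
  define D :: "real^'n^'n" where "D = monomial_matrix (\<lambda>i. if i = n then -1 else 1) id"
  have D: "D ** D = mat 1"
    unfolding D_def by (intro monomial_matrix_involution) auto
  have AD: "?A ** D = (\<chi> i j. if j = n then - of_bool (i = m \<or> i = n) else of_bool (i = j))" (is "_ = ?E")
    using assms
    by (auto simp: D_def matrix_mult_diagonal vec_eq_iff)
  have "?E ** ?E = mat 1"
  proof -
    have "(\<Sum>k\<in>UNIV. ?E $ i $ k * ?E $ k $ j) = mat 1 $ i $ j" for i j
    proof -
      \<comment> \<open>Only column \<open>n\<close> of \<open>?E\<close> has an entry off the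
        diagonal, so the other terms collapse to \<open>k = i\<close>.\<close>
      have "(\<Sum>k\<in>UNIV. ?E $ i $ k * ?E $ k $ j) =
          ?E $ i $ n * ?E $ n $ j + (\<Sum>k\<in>UNIV - {n}. ?E $ i $ k * ?E $ k $ j)"
        by (rule sum.remove) auto
      also have "(\<Sum>k\<in>UNIV - {n}. ?E $ i $ k * ?E $ k $ j) =
          (\<Sum>k\<in>UNIV - {n}. if k = i then ?E $ k $ j else 0)"
        by (intro sum.cong) auto
      also have "\<dots> = (if i = n then 0 else ?E $ i $ j)"
        by simp
      finally show ?thesis
        using assms by (auto simp: mat_def)
    qed
    then show ?thesis
      by (simp add: matrix_matrix_mult_def vec_eq_iff)
  qed
  then have "P (?A ** D)"
    unfolding AD by (rule involution)
  then have "P (?A ** D ** D)"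
    using mult involution[OF D] by blast
  then show ?thesis
    by (simp add: D flip: matrix_mul_assoc)
qed

text \<open>Induction over elementary factors does not keep the determinant at 1 or -1. A positive
  scalar carried along absorbs its size, and scalars commute with products.\<close>

lemma scaled_involution_products:
  assumes "invertible A"
  shows "\<exists>r>0. \<exists>B. P B \<and> A = r *\<^sub>R B"
  using assms
proof (induction A rule: induct_matrix_elementary_alt)
  case (1 A B)
  then have "invertible A" "invertible B"
    by (auto simp: invertible_det_nz det_mul)
  with 1 obtain r s A' B' where "r > 0" "s > 0" "P A'" "P B'" "A = r *\<^sub>R A'" "B = s *\<^sub>R B'"
    by blast
  then have "P (A' ** B')" "A ** B = (r * s) *\<^sub>R (A' ** B')" "r * s > 0"
    using mult by (auto simp: matrix_scalar_ac mult.commute simp flip: scalar_matrix_assoc)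
  then show ?case by blast
next
  case (2 A i)
  then show ?case
    by (simp add: invertible_det_nz det_zero_row)
next
  case (3 A)
  \<comment> \<open>Dividing by this root of the determinant leaves a diagonal matrix of determinant
    1 or -1.\<close>
  define r where "r = \<bar>det A\<bar> powr (1 / CARD('n))"
  have "r > 0"
    using 3 by (simp add: r_def invertible_det_nz)
  have r: "r ^ CARD('n) = \<bar>det A\<bar>"
    using 3 by (simp add: r_def invertible_det_nz powr_realpow[symmetric] powr_powr)
  define f where "f i = A $ i $ i / r" for i
  have "prod f UNIV = det A / r ^ CARD('n)"
    using 3 by (simp add: f_def prod_dividef det_diagonal)
  then have "\<bar>prod f UNIV\<bar> = 1"
    using r 3 by (simp add: invertible_det_nz)
  then have "P (monomial_matrix f id)"
    by (rule diagonal)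
  moreover have "A = r *\<^sub>R monomial_matrix f id"
    using 3 \<open>r > 0\<close> by (auto simp: monomial_matrix_def f_def vec_eq_iff)
  ultimately show ?case
    using \<open>r > 0\<close> by blast
next
  case (4 m n)
  have "(\<chi> i j. mat 1 $ i $ Transposition.transpose m n j) =
      1 *\<^sub>R monomial_matrix (\<lambda>_. 1) (Transposition.transpose m n)"
    by (auto simp: monomial_matrix_def mat_def vec_eq_iff)
  then show ?case
    using swap zero_less_one by blast
next
  case (5 m n)
  then have "P (\<chi> i j. of_bool (i = m \<and> j = n \<or> i = j))"
    by (intro shear)
  then show ?case
    by (intro exI[of _ 1]) auto
qed

end

text \<open>Adding the determinant condition to \<open>P\<close> in the previous result forces
  \<open>r ^ CARD('n) = 1\<close>, so the scalar disappears.\<close>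

lemma abs_det_1_induct [consumes 1, case_names involution mult]:
  fixes A :: "real^'n^'n"
  assumes "\<bar>det A\<bar> = 1"
    and involution: "\<And>A. A ** A = mat 1 \<Longrightarrow> P A"
    and mult: "\<And>A B. \<bar>det A\<bar> = 1 \<Longrightarrow> \<bar>det B\<bar> = 1 \<Longrightarrow> P A \<Longrightarrow> P B \<Longrightarrow> P (A ** B)"
  shows "P A"
proof -
  have "\<exists>r>0. \<exists>B. (\<bar>det B\<bar> = 1 \<and> P B) \<and> A = r *\<^sub>R B"
  proof (rule scaled_involution_products)
    show "invertible A"
      using assms(1) by (auto simp: invertible_det_nz)
  qed (auto simp: abs_det_involution involution mult det_mul abs_mult)
  then obtain r B where "r > 0" "\<bar>det B\<bar> = 1" "P B" and A: "A = r *\<^sub>R B"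
    by blast
  then have "r ^ CARD('n) = 1"
    using assms(1) by (simp add: det_scaleR abs_mult)
  then have "r = 1"
    using power_eq_iff_eq_base[of "CARD('n)" r 1] \<open>r > 0\<close> by simp
  with A \<open>P B\<close> show ?thesis by simp
qed

section \<open>Continuous multiplicative functions\<close>

text \<open>Cauchy's functional equation: additivity gives linearity on the rationals, and
  continuity extends it to their closure.\<close>

lemma continuous_additive_real:
  fixes g :: "real \<Rightarrow> real"
  assumes cont: "continuous_on UNIV g" and add: "\<And>x y. g (x + y) = g x + g y"
  shows "g x = x * g 1"
proof -
  interpret additive g
    by unfold_locales (rule add)
  have nat: "g (real n * y) = real n * g y" for n y
    by (induction n) (simp_all add: zero add algebra_simps)
  have int: "g (real_of_int k) = real_of_int k * g 1" for k
    using nat[of _ 1] by (cases k rule: int_cases2) (simp_all add: minus)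
  have rat: "g y - y * g 1 = 0" if y_rat: "y \<in> \<rat>" for y
  proof -
    obtain k :: int and n :: nat where "n \<noteq> 0" and y: "y = real_of_int k / real n"
      using y_rat unfolding Rats_eq_int_div_nat by blast
    have "real n * y = real_of_int k"
      using \<open>n \<noteq> 0\<close> y by simp
    then have "real n * g y = real_of_int k * g 1"
      by (metis nat int)
    then have "g y = y * g 1"
      using \<open>n \<noteq> 0\<close> unfolding y by (simp add: nonzero_eq_divide_eq mult.commute)
    then show ?thesis by simp
  qed
  have "g x - x * g 1 = 0"
  proof (rule continuous_constant_on_closure[where S = "\<rat>" and f = "\<lambda>x. g x - x * g 1"])
    show "continuous_on (closure \<rat>) (\<lambda>x. g x - x * g 1)"
      unfolding Rats_closure_real by (intro continuous_intros cont)
  qed (auto simp: rat Rats_closure_real)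
  then show ?thesis by simp
qed

text \<open>Conjugation by \<open>exp\<close> and \<open>ln\<close> turns multiplicativity into
  Cauchy's equation; the exponent is \<open>ln (c (exp 1))\<close>.\<close>

lemma continuous_multiplicative_powr:
  fixes c :: "real \<Rightarrow> real"
  assumes cont: "continuous_on {0<..} c" and pos: "\<And>t. t > 0 \<Longrightarrow> c t > 0"
    and mult: "\<And>s t. s > 0 \<Longrightarrow> t > 0 \<Longrightarrow> c (s * t) = c s * c t"
  obtains k where "\<And>t. t > 0 \<Longrightarrow> c t = t powr k"
proof
  define g where "g x = ln (c (exp x))" for x
  have "continuous_on UNIV (\<lambda>x. c (exp x))"
    by (rule continuous_on_compose2[OF cont]) (auto intro: continuous_intros)
  then have "continuous_on UNIV g"
    unfolding g_def using pos by (intro continuous_on_ln) (auto simp: less_imp_neq[THEN not_sym])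
  moreover have "g (x + y) = g x + g y" for x y
    by (simp add: g_def exp_add mult ln_mult_pos pos)
  ultimately have g: "g x = x * g 1" for x
    by (rule continuous_additive_real)
  show "c t = t powr g 1" if "t > 0" for t
  proof -
    have "c t = exp (g (ln t))"
      using that pos by (simp add: g_def)
    also have "\<dots> = t powr g 1"
      using that by (subst g) (simp add: powr_def mult.commute)
    finally show ?thesis .
  qed
qed

section \<open>Scores invariant under left multiplication\<close>

lemma left_invariant_score_eq_1:
  fixes S :: "real^'d^'d \<Rightarrow> real"
  assumes inv: "\<forall>Q\<in>GL. \<forall>Q'\<in>GL. \<forall>P\<in>GL. S Q \<ge> S Q' \<longleftrightarrow> S (P ** Q) \<ge> S (P ** Q')"
    and "\<bar>det A\<bar> = 1"
  shows "S A = S (mat 1)"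
  using assms(2)
proof (induction A rule: abs_det_1_induct)
  case (involution A)
  then have "A \<in> GL" "mat 1 \<in> GL"
    by (auto simp: GL_def invertible_def)
  \<comment> \<open>Left multiplication by \<open>A\<close> exchanges \<open>A\<close> and
    \<open>mat 1\<close>.\<close>
  then have "S A \<ge> S (mat 1) \<longleftrightarrow> S (mat 1) \<ge> S A"
    using inv involution by (metis matrix_mul_rid)
  then show ?case by linarith
next
  case (mult A B)
  then have "A \<in> GL" "B \<in> GL" "mat 1 \<in> GL"
    by (auto simp: GL_def invertible_det_nz)
  \<comment> \<open>Invariance in both directions preserves equality of scores; here
    \<open>A\<close> carries the equality for \<open>B\<close> and \<open>mat 1\<close>.\<close>
  then have "S (A ** B) = S (A ** mat 1)"
    using inv mult by (metis order_antisym order_refl)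
  with mult show ?case by simp
qed

text \<open>The exponent 0 is still allowed here; it is the case of a constant score.\<close>

lemma left_invariant_homogeneous_score:
  fixes S :: "real^'d^'d \<Rightarrow> real"
  assumes pos: "\<forall>Q\<in>GL. S Q > 0"
    and cont: "continuous_on {0<..} c" and c_pos: "\<forall>t>0. c t > 0"
    and inv: "\<forall>Q\<in>GL. \<forall>Q'\<in>GL. \<forall>P\<in>GL. S Q \<ge> S Q' \<longleftrightarrow> S (P ** Q) \<ge> S (P ** Q')"
    and hom: "\<forall>Q\<in>GL. \<forall>t>0. S (t *\<^sub>R Q) = c t * S Q"
  obtains \<beta> where "\<And>Q. Q \<in> GL \<Longrightarrow> S Q = S (mat 1) * gram_score Q powr \<beta>"
proof -
  have I: "mat 1 \<in> (GL :: (real^'d^'d) set)"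
    by (simp add: GL_def invertible_det_nz)
  \<comment> \<open>Scaling the identity by \<open>s * t\<close> at once or in two stages gives the
    same score, and \<open>S (mat 1) > 0\<close> cancels.\<close>
  have "c (s * t) = c s * c t" if "s > 0" "t > 0" for s t
  proof -
    have "t *\<^sub>R mat 1 \<in> (GL :: (real^'d^'d) set)"
      using that by (simp add: GL_def invertible_det_nz det_scaleR)
    then have "S (s *\<^sub>R (t *\<^sub>R mat 1)) = c s * (c t * S (mat 1))"
      using hom I that by (simp del: scaleR_scaleR)
    moreover have "S ((s * t) *\<^sub>R mat 1) = c (s * t) * S (mat 1)"
      using hom I that by (meson mult_pos_pos)
    ultimately show ?thesis
      using pos I by fastforce
  qed
  then obtain k where k: "\<And>t. t > 0 \<Longrightarrow> c t = t powr k"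
    using continuous_multiplicative_powr[OF cont] c_pos by metis
  \<comment> \<open>The exponent arises from \<open>r powr k\<close>, where \<open>r\<close> is the
    \<open>CARD('d)\<close>-th root of \<bar>det Q\<bar> and the Gram score is the square of det
    Q.\<close>
  have "S Q = S (mat 1) * gram_score Q powr (k / (2 * CARD('d)))" if "Q \<in> GL" for Q
  proof -
    have nz: "det Q \<noteq> 0"
      using that by (simp add: GL_def invertible_det_nz)
    define r where "r = \<bar>det Q\<bar> powr (1 / CARD('d))"
    have "r > 0"
      using nz by (simp add: r_def)
    have r: "r ^ CARD('d) = \<bar>det Q\<bar>"
      using nz by (simp add: r_def powr_realpow[symmetric] powr_powr)
    define R where "R = inverse r *\<^sub>R Q"
    have "\<bar>det R\<bar> = 1"
      using r nz \<open>r > 0\<close> by (simp add: R_def det_scaleR abs_mult power_inverse)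
    then have "S R = S (mat 1)" and "R \<in> GL"
      by (rule left_invariant_score_eq_1[OF inv], force simp: GL_def invertible_det_nz)
    moreover have "Q = r *\<^sub>R R"
      using \<open>r > 0\<close> by (simp add: R_def)
    ultimately have "S Q = r powr k * S (mat 1)"
      using hom k \<open>r > 0\<close> by simp
    also have "r powr k = \<bar>det Q\<bar> powr (2 * (k / (2 * CARD('d))))"
      by (simp add: r_def powr_powr)
    also have "\<dots> = (\<bar>det Q\<bar> powr 2) powr (k / (2 * CARD('d)))"
      by (simp only: powr_powr)
    also have "\<bar>det Q\<bar> powr 2 = gram_score Q"
      using nz by (simp add: gram_score_square)
    finally show ?thesis by simp
  qed
  then show ?thesis using that by blast
qed

theorem proposition4p3:
  shows "(\<forall>Q \<in> (GL :: (real^'d^'d) set). \<forall>Q' \<in> GL. \<forall>P \<in> (P_indep :: (real^'d^'y) set).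
            gram_score Q \<ge> gram_score Q' \<longleftrightarrow> gram_score (P ** Q) \<ge> gram_score (P ** Q'))
       \<and> (\<forall>(S :: real^'d^'d \<Rightarrow> real) (c :: real \<Rightarrow> real).
            continuous_on GL S \<longrightarrow> (\<forall>Q\<in>GL. S Q > 0) \<longrightarrow>
            continuous_on {0<..} c \<longrightarrow> (\<forall>t>0. c t > 0) \<longrightarrow>
            (\<forall>Q\<in>GL. \<forall>Q'\<in>GL. \<forall>P\<in>GL. S Q \<ge> S Q' \<longleftrightarrow> S (P ** Q) \<ge> S (P ** Q')) \<longrightarrow>
            (\<forall>Q\<in>GL. \<forall>t>0. S (t *\<^sub>R Q) = c t * S Q) \<longrightarrow>
            \<not> S constant_on GL \<longrightarrow>
            (\<exists>\<alpha>>0. \<exists>\<beta>. \<beta> \<noteq> 0 \<and> (\<forall>Q\<in>GL. S Q = \<alpha> * gram_score Q powr \<beta>)))"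
proof (intro conjI ballI allI impI)
  fix Q Q' :: "real^'d^'d" and P :: "real^'d^'y"
  assume "P \<in> P_indep"
  then have "gram_score P > 0"
    by (simp add: P_indep_def gram_score_pos)
  \<comment> \<open>Both sides on the right carry the positive factor \<open>gram_score P\<close>,
    which cancels.\<close>
  then show "gram_score Q \<ge> gram_score Q' \<longleftrightarrow> gram_score (P ** Q) \<ge> gram_score (P ** Q')"
    by (simp add: gram_score_mult gram_score_square)
next
  fix S :: "real^'d^'d \<Rightarrow> real" and c :: "real \<Rightarrow> real"
  assume pos: "\<forall>Q\<in>GL. S Q > 0"
    and cont: "continuous_on {0<..} c" and c_pos: "\<forall>t>0. c t > 0"
    and inv: "\<forall>Q\<in>GL. \<forall>Q'\<in>GL. \<forall>P\<in>GL. S Q \<ge> S Q' \<longleftrightarrow> S (P ** Q) \<ge> S (P ** Q')"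
    and hom: "\<forall>Q\<in>GL. \<forall>t>0. S (t *\<^sub>R Q) = c t * S Q"
    and nonconst: "\<not> S constant_on GL"
  obtain \<beta> where \<beta>: "\<And>Q. Q \<in> GL \<Longrightarrow> S Q = S (mat 1) * gram_score Q powr \<beta>"
    using left_invariant_homogeneous_score[OF pos cont c_pos inv hom] by blast
  have "\<beta> \<noteq> 0"
  proof
    assume "\<beta> = 0"
    \<comment> \<open>The Gram score is nonzero on \<open>GL\<close>, so its power with exponent 0
      is 1 rather than the default \<open>0 powr 0 = 0\<close>.\<close>
    then have "S Q = S (mat 1)" if "Q \<in> GL" for Q
      using \<beta>[OF that] that by (simp add: gram_score_square GL_def invertible_det_nz)
    with nonconst show False
      by (auto simp: constant_on_def)
  qed
  moreover have "S (mat 1) > 0"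
    using pos by (simp add: GL_def invertible_det_nz)
  ultimately show "\<exists>\<alpha>>0. \<exists>\<beta>. \<beta> \<noteq> 0 \<and> (\<forall>Q\<in>GL. S Q = \<alpha> * gram_score Q powr \<beta>)"
    using \<beta> by blast
qed

end
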